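(* If an angle of a triangle is not inscribed, then the side of the triangle opposite that angle does not have a taxicab excircle.
   Context: All triangles are non-degenerate and lie in $\mathbb{R}^2$ with the taxicab distance $d((x_1,y_1),(x_2,y_2))=|x_1-x_2|+|y_1-y_2|$. A taxicab circle of center $P$ and radius $r>0$ is $\{Q: d(P,Q)=r\}$ (a square with sides of slope $\pm1$); its closed disk is $\{Q:d(P,Q)\le r\}$. Inscribed angles: an angle (of a triangle) with vertex $V$ is positively inscribed if the line of slope $+1$ through $V$ does not meet the interior of the angle, and negatively inscribed if the line of slope $-1$ through $V$ does not meet the interior of the angle. It is inscribed if it is at least one of the two. Excircles: an excircle of a triangle at a side is a taxicab circle outside the triangle that is tangent to that side and tangent to both rays forming the angle of the triangle opposite that side. Precisely, for the side $\overline{AB}$ of $\triangle ABC$: its closed disk lies in the closed angular region $\angle ACB$ and in the closed half-plane bounded by line $AB$ not containing $C$, and the circle has at least one point in common with the segment $\overline{AB}$, with the ray from $C$ through $A$, and with the ray from $C$ through $B$ (contact may be at a corner of the circle, along a segment, or at a vertex of the triangle). *)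

theory Defs
  imports "HOL-Analysis.Analysis"
begin

type_synonym point = "real \<times> real"

definition taxi_dist :: "point \<Rightarrow> point \<Rightarrow> real" where
  "taxi_dist P Q = \<bar>fst P - fst Q\<bar> + \<bar>snd P - snd Q\<bar>"

definition taxi_circle :: "point \<Rightarrow> real \<Rightarrow> point set" where
  "taxi_circle P r = {Q. taxi_dist P Q = r}"

definition taxi_disk :: "point \<Rightarrow> real \<Rightarrow> point set" where
  "taxi_disk P r = {Q. taxi_dist P Q \<le> r}"

definition nondegenerate_triangle :: "point \<Rightarrow> point \<Rightarrow> point \<Rightarrow> bool" where
  "nondegenerate_triangle A B C \<longleftrightarrow> \<not> collinear {A, B, C}"

definition ray :: "point \<Rightarrow> point \<Rightarrow> point set" where
  "ray V A = {V + t *\<^sub>R (A - V) | t. t \<ge> 0}"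

text \<open>The closed angular region with vertex \<open>V\<close> (the first argument) and sides the rays
  from \<open>V\<close> through \<open>A\<close> and \<open>B\<close>.\<close>

definition angle_region :: "point \<Rightarrow> point \<Rightarrow> point \<Rightarrow> point set" where
  "angle_region V A B = {V + s *\<^sub>R (A - V) + t *\<^sub>R (B - V) | s t. s \<ge> 0 \<and> t \<ge> 0}"

text \<open>The closed half-plane bounded by the line \<open>AB\<close> that does not contain \<open>C\<close>. In the affine
  coordinates with origin \<open>A\<close> and axes \<open>AB\<close>, \<open>AC\<close>, the line is \<open>t = 0\<close> and \<open>C\<close> has \<open>t = 1\<close>;
  this is meaningful only when \<open>A\<close>, \<open>B\<close>, \<open>C\<close> are not collinear.\<close>

definition opposite_half_plane :: "point \<Rightarrow> point \<Rightarrow> point \<Rightarrow> point set" where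
  "opposite_half_plane A B C = {A + s *\<^sub>R (B - A) + t *\<^sub>R (C - A) | s t. t \<le> 0}"

definition line_of_slope :: "real \<Rightarrow> point \<Rightarrow> point set" where
  "line_of_slope m V = {Q. snd Q - snd V = m * (fst Q - fst V)}"

definition positively_inscribed :: "point \<Rightarrow> point \<Rightarrow> point \<Rightarrow> bool" where
  "positively_inscribed V A B \<longleftrightarrow> line_of_slope 1 V \<inter> interior (angle_region V A B) = {}"

definition negatively_inscribed :: "point \<Rightarrow> point \<Rightarrow> point \<Rightarrow> bool" where
  "negatively_inscribed V A B \<longleftrightarrow> line_of_slope (- 1) V \<inter> interior (angle_region V A B) = {}"

definition inscribed :: "point \<Rightarrow> point \<Rightarrow> point \<Rightarrow> bool" where
  "inscribed V A B \<longleftrightarrow> positively_inscribed V A B \<or> negatively_inscribed V A B"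

text \<open>The circle with center \<open>P\<close> and radius \<open>r\<close> is an excircle of the triangle \<open>ABC\<close> at the
  side \<open>AB\<close>, which is opposite the last argument \<open>C\<close>. Contact is required of the circle itself,
  not merely of its disk.\<close>

definition taxi_excircle :: "point \<Rightarrow> real \<Rightarrow> point \<Rightarrow> point \<Rightarrow> point \<Rightarrow> bool" where
  "taxi_excircle P r A B C \<longleftrightarrow>
     r > 0 \<and>
     taxi_disk P r \<subseteq> angle_region C A B \<and>
     taxi_disk P r \<subseteq> opposite_half_plane A B C \<and>
     taxi_circle P r \<inter> closed_segment A B \<noteq> {} \<and>
     taxi_circle P r \<inter> ray C A \<noteq> {} \<and>
     taxi_circle P r \<inter> ray C B \<noteq> {}"

definition has_taxi_excircle :: "point \<Rightarrow> point \<Rightarrow> point \<Rightarrow> bool" where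
  "has_taxi_excircle A B C \<longleftrightarrow> (\<exists>P r. taxi_excircle P r A B C)"

end

theory Submission
  imports Defs
begin

text \<open>If the angle at \<open>C\<close> is not inscribed, its interior contains one direction from each of the two
  diagonals, \<open>(e, e)\<close> and \<open>(d, - d)\<close> with \<open>e, d = \<plusminus>1\<close>. A taxicab disk is a square with sides parallel
  to these directions, so each affine coordinate of the angle attains its minimum over the disk
  only at the corner facing \<open>C\<close>. A circle in the angular region that touches both rays therefore
  touches both at that corner, which must be \<open>C\<close>; but \<open>C\<close> is not in the opposite half-plane.\<close>

definition cross2 :: "point \<Rightarrow> point \<Rightarrow> real" where
  "cross2 u v = fst u * snd v - snd u * fst v"

lemma linear_cross2_left: "linear (\<lambda>u. cross2 u v)"
  by (rule linearI) (simp_all add: cross2_def algebra_simps)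

lemma linear_cross2_right: "linear (cross2 u)"
  by (rule linearI) (simp_all add: cross2_def algebra_simps)

lemma cross2_self [simp]: "cross2 u u = 0"
  by (simp add: cross2_def)

lemma collinear_if_cross2_eq_0:
  assumes "cross2 (A - C) (B - C) = 0"
  shows "collinear {A, B, C}"
proof -
  define a b where "a = A - C" and "b = B - C"
  have eq: "fst a * snd b = snd a * fst b"
    using assms by (simp add: cross2_def a_def b_def)
  have "a = 0 \<or> (\<exists>c. b = c *\<^sub>R a)"
  proof (cases "fst a = 0")
    case True
    show ?thesis
    proof (cases "snd a = 0")
      case True
      with \<open>fst a = 0\<close> show ?thesis by (simp add: prod_eq_iff)
    next
      case False
      with eq have "b = (snd b / snd a) *\<^sub>R a"
        by (simp add: prod_eq_iff field_simps)
      then show ?thesis by blast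
    qed
  next
    case False
    with eq have "b = (fst b / fst a) *\<^sub>R a"
      by (simp add: prod_eq_iff field_simps)
    then show ?thesis by blast
  qed
  \<comment> \<open>\<open>C\<close> stands in the middle because \<open>collinear_3\<close> takes
    the middle point as origin, which yields the differences \<open>a\<close> and
    \<open>b\<close>.\<close>
  then have "collinear {A, C, B}"
    by (subst collinear_3) (auto simp: collinear_lemma a_def b_def)
  then show ?thesis by (simp add: insert_commute)
qed

text \<open>Cramer's rule: the coordinates are quotients of determinants, and non-collinearity makes
  the denominator nonzero.\<close>

lemma obtain_affine_coordinates:
  assumes "\<not> collinear {A, B, C}"
  obtains \<sigma> \<tau> :: "point \<Rightarrow> real" where "linear \<sigma>" "linear \<tau>"
    "\<sigma> (A - C) = 1" "\<sigma> (B - C) = 0" "\<tau> (A - C) = 0" "\<tau> (B - C) = 1"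
    "\<And>v. v = \<sigma> v *\<^sub>R (A - C) + \<tau> v *\<^sub>R (B - C)"
proof -
  define a b where "a = A - C" and "b = B - C"
  have D: "cross2 a b \<noteq> 0"
    using assms collinear_if_cross2_eq_0 unfolding a_def b_def by blast
  define \<sigma> \<tau> where "\<sigma> = (\<lambda>v. (1 / cross2 a b) *\<^sub>R cross2 v b)"
    and "\<tau> = (\<lambda>v. (1 / cross2 a b) *\<^sub>R cross2 a v)"
  have "v = \<sigma> v *\<^sub>R a + \<tau> v *\<^sub>R b" for v
  proof -
    have "cross2 a b *\<^sub>R v = cross2 v b *\<^sub>R a + cross2 a v *\<^sub>R b"
      by (simp add: prod_eq_iff cross2_def algebra_simps)
    then have "(1 / cross2 a b) *\<^sub>R cross2 a b *\<^sub>R v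
        = (1 / cross2 a b) *\<^sub>R (cross2 v b *\<^sub>R a + cross2 a v *\<^sub>R b)"
      by simp
    with D show ?thesis
      by (simp add: \<sigma>_def \<tau>_def scaleR_right_distrib)
  qed
  moreover have "linear \<sigma>" "linear \<tau>"
    unfolding \<sigma>_def \<tau>_def
    by (intro linear_compose_scale_right linear_cross2_left linear_cross2_right)+
  moreover have "\<sigma> a = 1" "\<sigma> b = 0" "\<tau> a = 0" "\<tau> b = 1"
    using D by (simp_all add: \<sigma>_def \<tau>_def)
  ultimately show thesis
    using that unfolding a_def b_def by blast
qed

text \<open>From an interior point a short step along \<open>- w\<close> stays in \<open>S\<close>
  but strictly lowers \<open>f\<close>, so the value there cannot already be zero.\<close>

lemma linear_pos_on_interior:
  fixes f :: "'a::real_normed_vector \<Rightarrow> real"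
  assumes "linear f" and nonneg: "\<And>Q. Q \<in> S \<Longrightarrow> f (Q - V) \<ge> 0"
    and "f w > 0" and "X \<in> interior S"
  shows "f (X - V) > 0"
proof -
  obtain \<epsilon> where "\<epsilon> > 0" and sub: "ball X \<epsilon> \<subseteq> S"
    using \<open>X \<in> interior S\<close> mem_interior by blast
  have "w \<noteq> 0"
    using \<open>f w > 0\<close> linear_0[OF \<open>linear f\<close>] by auto
  define \<delta> where "\<delta> = \<epsilon> / (2 * norm w)"
  have "\<delta> > 0"
    using \<open>\<epsilon> > 0\<close> \<open>w \<noteq> 0\<close> by (simp add: \<delta>_def)
  have "X - \<delta> *\<^sub>R w \<in> ball X \<epsilon>"
    using \<open>\<epsilon> > 0\<close> \<open>w \<noteq> 0\<close> by (simp add: dist_norm \<delta>_def)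
  then have "f (X - \<delta> *\<^sub>R w - V) \<ge> 0"
    using sub nonneg by blast
  also have "f (X - \<delta> *\<^sub>R w - V) = f (X - V) - \<delta> * f w"
    using \<open>linear f\<close> by (simp add: linear_diff linear_scale)
  finally show ?thesis
    using mult_pos_pos[OF \<open>\<delta> > 0\<close> \<open>f w > 0\<close>] by linarith
qed

text \<open>The disk lies in the cone spanned by \<open>(e, e)\<close> and \<open>(d, - d)\<close>
  at one of its corners. Since \<sigma> strictly increases along both directions, it can vanish only
  at that apex. One of \<open>e + d\<close>, \<open>e - d\<close> is 0 and the other is 2 or -2, so
  the factor \<open>r / 2\<close> gives a shift of length \<open>r\<close> along an axis.\<close>

lemma taxi_disk_contact_at_corner:
  fixes \<sigma> :: "point \<Rightarrow> real"
  assumes "linear \<sigma>" and "\<sigma> (e, e) > 0" and "\<sigma> (d, - d) > 0"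
    and "e = 1 \<or> e = - 1" and "d = 1 \<or> d = - 1" and "r > 0"
    and nonneg: "\<And>Q. Q \<in> taxi_disk P r \<Longrightarrow> \<sigma> (Q - C) \<ge> 0"
    and "T \<in> taxi_disk P r" and "\<sigma> (T - C) = 0"
  shows "T = P - (r / 2) *\<^sub>R (e + d, e - d)"
proof -
  define Q where "Q = P - (r / 2) *\<^sub>R (e + d, e - d)"
  \<comment> \<open>The coordinates of \<open>T - Q\<close> along the two diagonals; multiplying by
    \<open>e\<close> or \<open>d\<close> also divides by it, both being signs.\<close>
  define \<alpha> where "\<alpha> = e * (fst (T - Q) + snd (T - Q)) / 2"
  define \<beta> where "\<beta> = d * (fst (T - Q) - snd (T - Q)) / 2"
  have "Q \<in> taxi_disk P r"
    using assms(4-6) by (auto simp: Q_def taxi_disk_def taxi_dist_def)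
  then have "\<sigma> (Q - C) \<ge> 0"
    by (rule nonneg)
  have T: "T - Q = \<alpha> *\<^sub>R (e, e) + \<beta> *\<^sub>R (d, - d)"
    using assms(4,5) by (auto simp: \<alpha>_def \<beta>_def prod_eq_iff field_simps)
  \<comment> \<open>Relative to \<open>P\<close>, the sum and the difference of the coordinates lie
    between \<open>- r\<close> and \<open>r\<close> on the disk; at \<open>Q\<close> they are
    \<open>- e * r\<close> and \<open>- d * r\<close>, both extreme.\<close>
  have "\<alpha> \<ge> 0" "\<beta> \<ge> 0"
    using assms(4-6,8)
    by (auto simp: \<alpha>_def \<beta>_def Q_def taxi_disk_def taxi_dist_def)
  have "T - C = (T - Q) + (Q - C)"
    by simp
  then have "\<sigma> (T - C) = \<alpha> * \<sigma> (e, e) + \<beta> * \<sigma> (d, - d) + \<sigma> (Q - C)"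
    using \<open>linear \<sigma>\<close> unfolding T by (simp only: linear_add linear_scale real_scaleR_def)
  moreover have "\<alpha> * \<sigma> (e, e) \<ge> 0" "\<beta> * \<sigma> (d, - d) \<ge> 0"
    using \<open>\<alpha> \<ge> 0\<close> \<open>\<beta> \<ge> 0\<close> assms(2,3) by simp_all
  ultimately have "\<alpha> * \<sigma> (e, e) = 0" "\<beta> * \<sigma> (d, - d) = 0"
    using \<open>\<sigma> (T - C) = 0\<close> \<open>\<sigma> (Q - C) \<ge> 0\<close> by linarith+
  then have "\<alpha> = 0" "\<beta> = 0"
    using assms(2,3) by simp_all
  with T show ?thesis
    by (simp add: Q_def prod_eq_iff)
qed

text \<open>Dividing by the positive number \<open>\<bar>x\<bar>\<close> keeps the sign, so a
  direction of slope \<open>m\<close> may be normalised to first coordinate 1 or -1.\<close>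

lemma linear_pos_sgn:
  fixes \<sigma> :: "point \<Rightarrow> real"
  assumes "linear \<sigma>" and "\<sigma> (x, m * x) > 0"
  shows "\<sigma> (sgn x, m * sgn x) > 0"
proof -
  have "x \<noteq> 0"
    using assms linear_0 by (fastforce simp: zero_prod_def)
  have "(x, m * x) = \<bar>x\<bar> *\<^sub>R (sgn x, m * sgn x)"
    by (simp add: algebra_simps abs_mult_sgn)
  then have "\<sigma> (x, m * x) = \<bar>x\<bar> * \<sigma> (sgn x, m * sgn x)"
    using \<open>linear \<sigma>\<close> by (simp only: linear_scale real_scaleR_def)
  with assms(2) \<open>x \<noteq> 0\<close> show ?thesis
    by (simp add: zero_less_mult_iff)
qed

theorem lemma1:
  fixes A B C :: point
  assumes "nondegenerate_triangle A B C"
    and "\<not> inscribed C A B"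
  shows "\<not> has_taxi_excircle A B C"
proof
  assume "has_taxi_excircle A B C"
  then obtain P r where "r > 0"
    and angle: "taxi_disk P r \<subseteq> angle_region C A B"
    and half: "taxi_disk P r \<subseteq> opposite_half_plane A B C"
    and "taxi_circle P r \<inter> ray C A \<noteq> {}" "taxi_circle P r \<inter> ray C B \<noteq> {}"
    unfolding has_taxi_excircle_def taxi_excircle_def by blast
  then obtain S T where S: "S \<in> taxi_circle P r" "S \<in> ray C A"
    and T: "T \<in> taxi_circle P r" "T \<in> ray C B"
    by blast
  obtain \<sigma> \<tau> :: "point \<Rightarrow> real" where lin: "linear \<sigma>" "linear \<tau>"
    and basis: "\<sigma> (A - C) = 1" "\<sigma> (B - C) = 0" "\<tau> (A - C) = 0" "\<tau> (B - C) = 1"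
    and coords: "\<And>v. v = \<sigma> v *\<^sub>R (A - C) + \<tau> v *\<^sub>R (B - C)"
    using assms(1) obtain_affine_coordinates unfolding nondegenerate_triangle_def by metis
  have nonneg: "\<sigma> (Q - C) \<ge> 0" "\<tau> (Q - C) \<ge> 0" if "Q \<in> angle_region C A B" for Q
    using that lin basis
    by (auto simp: angle_region_def linear_add linear_scale add.assoc)
  have pos: "\<sigma> (X - C) > 0" "\<tau> (X - C) > 0" if "X \<in> interior (angle_region C A B)" for X
    using that linear_pos_on_interior[OF lin(1) nonneg(1), of _ "A - C"]
      linear_pos_on_interior[OF lin(2) nonneg(2), of _ "B - C"] basis by auto
  \<comment> \<open>A single sign \<open>e\<close> has to serve both coordinates; the slope stays
    general so that \<open>m = 1\<close> and \<open>m = - 1\<close> share the argument.\<close>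
  have diagonal: "\<exists>e. (e = 1 \<or> e = - 1) \<and> \<sigma> (e, m * e) > 0 \<and> \<tau> (e, m * e) > 0"
    if meet: "line_of_slope m C \<inter> interior (angle_region C A B) \<noteq> {}" for m
  proof -
    obtain X where "X \<in> line_of_slope m C" and X: "X \<in> interior (angle_region C A B)"
      using meet by blast
    define x where "x = fst (X - C)"
    have x: "X - C = (x, m * x)"
      using \<open>X \<in> line_of_slope m C\<close> by (simp add: x_def line_of_slope_def prod_eq_iff)
    have "x \<noteq> 0"
      using pos(1)[OF X] linear_0[OF lin(1)] unfolding x by (auto simp: zero_prod_def)
    then have "sgn x = 1 \<or> sgn x = - 1"
      by (simp add: sgn_if)
    moreover have "\<sigma> (sgn x, m * sgn x) > 0" "\<tau> (sgn x, m * sgn x) > 0"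
      using pos[OF X] lin unfolding x by (auto intro: linear_pos_sgn)
    ultimately show ?thesis by blast
  qed
  obtain e where e: "e = 1 \<or> e = - 1" "\<sigma> (e, e) > 0" "\<tau> (e, e) > 0"
    using diagonal[of 1] assms(2)
    by (auto simp: inscribed_def positively_inscribed_def)
  obtain d where d: "d = 1 \<or> d = - 1" "\<sigma> (d, - d) > 0" "\<tau> (d, - d) > 0"
    using diagonal[of "- 1"] assms(2)
    by (auto simp: inscribed_def negatively_inscribed_def)
  have disk: "S \<in> taxi_disk P r" "T \<in> taxi_disk P r"
    using S(1) T(1) by (auto simp: taxi_circle_def taxi_disk_def)
  \<comment> \<open>Each coordinate vanishes on the ray spanned by the other basis vector.\<close>
  have zero: "\<tau> (S - C) = 0" "\<sigma> (T - C) = 0"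
    using S(2) T(2) lin basis by (auto simp: ray_def linear_scale)
  have "S = P - (r / 2) *\<^sub>R (e + d, e - d)"
    using taxi_disk_contact_at_corner[OF lin(2) e(3) d(3) e(1) d(1) \<open>r > 0\<close> _ disk(1) zero(1)]
      nonneg(2) angle by blast
  moreover have "T = P - (r / 2) *\<^sub>R (e + d, e - d)"
    using taxi_disk_contact_at_corner[OF lin(1) e(2) d(2) e(1) d(1) \<open>r > 0\<close> _ disk(2) zero(2)]
      nonneg(1) angle by blast
  \<comment> \<open>Both contacts are the same corner, so \<sigma> and \<tau> vanish together
    there.\<close>
  ultimately have "S - C = 0"
    using coords[of "S - C"] zero by simp
  then have "C \<in> opposite_half_plane A B C"
    using disk(1) half by auto
  then obtain s t where "t \<le> 0" and C: "C = A + s *\<^sub>R (B - A) + t *\<^sub>R (C - A)"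
    unfolding opposite_half_plane_def by blast
  \<comment> \<open>Rewriting in the basis \<open>A - C\<close>, \<open>B - C\<close> lets \<sigma>
    and \<tau> read off the coefficients; they force \<open>t = 1\<close>, against
    \<open>t \<le> 0\<close>.\<close>
  have "(1 - s - t) *\<^sub>R (A - C) + s *\<^sub>R (B - C) = A + s *\<^sub>R (B - A) + t *\<^sub>R (C - A) - C"
    by (simp add: algebra_simps)
  also have "\<dots> = 0"
    using C by simp
  finally have 0: "(1 - s - t) *\<^sub>R (A - C) + s *\<^sub>R (B - C) = 0" .
  have "1 - s - t = 0" "s = 0"
    using arg_cong[OF 0, of \<sigma>] arg_cong[OF 0, of \<tau>] lin basis
    by (simp_all add: linear_add linear_scale linear_0)
  with \<open>t \<le> 0\<close> show False by simp
qed

end
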